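(* Let $K$ be an algebraically closed field, $1\le d\le n-1$, $X\le K^n$ a linear subspace of dimension $d+1$ with Plücker coordinates $(q_I)_{I\in\binom{[n]}{d+1}}$, and $S\subseteq[n]$, and suppose there is $C\in\binom{[n]}{d+1}$ with $S\subseteq C$ and $q_C\ne0$. Let $X^S$ be the row space of the matrix $W^S$ defined from $X,S,C$ in the context. Then $$L^S(X)=L(X^S).$$ Thus $L^S(X)$ is of (projective) dimension $d$, and it may be written as the (projectivized) row space of the $(d+1)\times\binom{n}{d}$ matrix $V^S$ with entries $$V^S_{i,J}=\det\bigl(e_i\mid (W^S)^J\bigr),\qquad J\in\tbinom{[n]}{d},$$ where $(e_i\mid (W^S)^J)$ is obtained by prepending the $i$-th standard unit vector of $K^{d+1}$ (the rows being indexed by $C$) to the submatrix $(W^S)^J$ of $W^S$ with columns $J$.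
   Context: $\mathrm{Gr}(d,n)\subseteq\mathbb{P}^{\binom{n}{d}-1}$ is the Grassmannian in its Plücker embedding. $\mathrm{pr}_S:K^n\to K^n$ kills $e_i$ for $i\in S$ and fixes $e_i$ for $i\notin S$. $L^S(X)=\{Y\in \mathrm{Gr}(d,n):\mathrm{pr}_S(Y)\subseteq X\}$ and $L(X)=L^{\emptyset}(X)$. Since $q_C\neq0$, $X$ is the row space of a unique matrix $W\in K^{(d+1)\times n}$ whose submatrix with columns $C$ is the identity. Index the rows of $W$ by $C$ (identifying $[d+1]$ with $C$ in order-preserving fashion). Define $W^S\in K^{(d+1)\times n}$ row-wise: for $i\in C$, the $i$-th row of $W^S$ is the standard unit vector $e_i^T$ of $K^n$ if $i\in S$, and equals the $i$-th row of $W$ if $i\notin S$. *)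

theory Defs
  imports
    "Jordan_Normal_Form.VS_Connect"
    "Jordan_Normal_Form.Determinant"
    "Jordan_Normal_Form.DL_Submatrix"
begin

text \<open>Indices are zero-based: the set $[n]$ is rendered as \<open>{0..<n}\<close>. Vectors in $K^n$ are the elements
  of \<^term>\<open>carrier_vec n\<close>; a subspace of $K^n$ is a set of such vectors.\<close>

definition subspace_of :: "nat \<Rightarrow> 'a::field vec set \<Rightarrow> bool" where
  "subspace_of n U \<longleftrightarrow> VectorSpace.subspace class_ring U (module_vec TYPE('a) n)"

definition subspace_dim :: "nat \<Rightarrow> 'a::field vec set \<Rightarrow> nat" where
  "subspace_dim n U = vectorspace.dim class_ring ((module_vec TYPE('a) n)\<lparr>carrier := U\<rparr>)"

abbreviation span_of :: "nat \<Rightarrow> 'a::field vec set \<Rightarrow> 'a vec set" where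
  "span_of n A \<equiv> LinearCombinations.module.span class_ring (module_vec TYPE('a) n) A"

text \<open>A point of a projective space is a line through the origin; a projectivized subspace is
  the set of the lines it contains.\<close>

definition projectivization :: "nat \<Rightarrow> 'a::field vec set \<Rightarrow> 'a vec set set" where
  "projectivization N U = {span_of N {v} | v. v \<in> U \<and> v \<noteq> 0\<^sub>v N}"

definition linear_of_proj_dim :: "nat \<Rightarrow> 'a::field vec set set \<Rightarrow> nat \<Rightarrow> bool" where
  "linear_of_proj_dim N Z m \<longleftrightarrow>
     (\<exists>U. subspace_of N U \<and> subspace_dim N U = m + 1 \<and> Z = projectivization N U)"

definition grassmannian :: "nat \<Rightarrow> nat \<Rightarrow> 'a::field vec set set" where
  "grassmannian d n = {Y. subspace_of n Y \<and> subspace_dim n Y = d}"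

text \<open>The \<open>k\<close>-element subsets of \<open>{0..<n}\<close>, in lexicographic order; this order fixes the coordinates of
  the ambient space of the Pluecker embedding.\<close>

definition k_subsets :: "nat \<Rightarrow> nat \<Rightarrow> nat set list" where
  "k_subsets n k = map set (filter (\<lambda>xs. length xs = k) (subseqs [0..<n]))"

definition columns :: "'a mat \<Rightarrow> nat set \<Rightarrow> 'a mat" where
  "columns A J = submatrix A UNIV J"

text \<open>Being homogeneous, these coordinates are determined only up to a common nonzero factor, so \<open>q\<close> is
  related to \<open>Y\<close> by a predicate.\<close>

definition plucker_coords :: "nat \<Rightarrow> nat \<Rightarrow> 'a::field vec set \<Rightarrow> (nat set \<Rightarrow> 'a) \<Rightarrow> bool" where
  "plucker_coords n k Y q \<longleftrightarrow>
     (\<exists>A \<in> carrier_mat k n. vec_space.row_space n A = Y \<and>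
       (\<exists>c. c \<noteq> 0 \<and> (\<forall>I \<subseteq> {0..<n}. card I = k \<longrightarrow> q I = c * det (columns A I))))"

text \<open>For a \<open>k\<close>-dimensional \<open>Y\<close> the coordinate vectors below are all proportional, so that their span is
  the line representing the image of \<open>Y\<close>.\<close>

definition plucker_embedding :: "nat \<Rightarrow> nat \<Rightarrow> 'a::field vec set \<Rightarrow> 'a vec set" where
  "plucker_embedding n k Y =
     span_of (n choose k) {vec (n choose k) (\<lambda>j. q (k_subsets n k ! j)) | q. plucker_coords n k Y q}"

definition pr :: "nat \<Rightarrow> nat set \<Rightarrow> 'a::field vec \<Rightarrow> 'a vec" where
  "pr n S v = vec n (\<lambda>i. if i \<in> S then 0 else v $ i)"

definition LS :: "nat \<Rightarrow> nat \<Rightarrow> nat set \<Rightarrow> 'a::field vec set \<Rightarrow> 'a vec set set" where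
  "LS d n S X = {Y \<in> grassmannian d n. pr n S ` Y \<subseteq> X}"

definition L :: "nat \<Rightarrow> nat \<Rightarrow> 'a::field vec set \<Rightarrow> 'a vec set set" where
  "L d n X = LS d n {} X"

text \<open>Existence and uniqueness hold when \<open>X\<close> has dimension \<^term>\<open>card C\<close> and its Pluecker coordinate at
  \<open>C\<close> does not vanish.\<close>

definition normalized_matrix :: "nat \<Rightarrow> nat set \<Rightarrow> 'a::field vec set \<Rightarrow> 'a mat" where
  "normalized_matrix n C X =
     (THE W. W \<in> carrier_mat (card C) n \<and> vec_space.row_space n W = X \<and> columns W C = 1\<^sub>m (card C))"

text \<open>Row \<open>k\<close> carries the label \<^term>\<open>pick C k\<close>, the \<open>k\<close>-th smallest element of \<open>C\<close>.\<close>

definition W_S :: "nat \<Rightarrow> nat set \<Rightarrow> nat set \<Rightarrow> 'a::field vec set \<Rightarrow> 'a mat" where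
  "W_S n S C X = mat_of_rows n
     (map (\<lambda>k. if pick C k \<in> S then unit_vec n (pick C k) else row (normalized_matrix n C X) k)
       [0..<card C])"

definition X_S :: "nat \<Rightarrow> nat set \<Rightarrow> nat set \<Rightarrow> 'a::field vec set \<Rightarrow> 'a vec set" where
  "X_S n S C X = vec_space.row_space n (W_S n S C X)"

definition prepend_col :: "'a vec \<Rightarrow> 'a mat \<Rightarrow> 'a mat" where
  "prepend_col v A = mat_of_cols (dim_row A) (v # cols A)"

definition V_S :: "nat \<Rightarrow> nat \<Rightarrow> nat set \<Rightarrow> nat set \<Rightarrow> 'a::field vec set \<Rightarrow> 'a mat" where
  "V_S d n S C X = mat (d + 1) (n choose d)
     (\<lambda>(i, j). det (prepend_col (unit_vec (d + 1) i) (columns (W_S n S C X) (k_subsets n d ! j))))"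

end

theory Submission
  imports Defs "Jordan_Normal_Form.DL_Rank"
begin

text \<open>
  The equality of \<open>L\<^sup>S(X)\<close> and \<open>L(X\<^sup>S)\<close> is a statement about single vectors: \<open>pr\<^sub>S y \<in> X\<close> if and only
  if \<open>y \<in> X\<^sup>S\<close> (\<open>pr_mem_iff_mem_X_S\<close>). Since the columns \<open>C\<close> of \<open>W\<close> form the identity matrix, the
  coordinates in \<open>C\<close> of a vector of \<open>X\<close> are its coefficients with respect to the rows of \<open>W\<close>. If
  \<open>pr\<^sub>S y\<close> lies in \<open>X\<close>, its coefficients are therefore \<open>y\<^sub>i\<close> for \<open>i \<in> C - S\<close> and \<open>0\<close> for \<open>i \<in> S\<close>;
  adding back the entries of \<open>y\<close> in \<open>S\<close> as multiples of unit vectors writes \<open>y\<close> as a combination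
  of the rows of \<open>W\<^sup>S\<close>. Conversely \<open>pr\<^sub>S\<close> kills the rows of \<open>W\<^sup>S\<close> labelled by \<open>S\<close> and fixes the
  others, because these vanish in the columns \<open>S \<subseteq> C\<close>.

  It remains to describe the image of \<open>L(X\<^sup>S)\<close> in the Pluecker space, and this is done for any
  \<open>(d + 1) \<times> n\<close> matrix \<open>W\<close> in which the columns \<open>C\<close> form the identity, as they do in \<open>W\<^sup>S\<close>.
  A hyperplane \<open>Y\<close> of its row space is the row space of a product \<open>B W\<close>, where \<open>B\<close> is
  \<open>d \<times> (d + 1)\<close> with independent rows, and it is determined by the line of vectors \<open>v\<close> with
  \<open>B v = 0\<close>. Complete \<open>B\<close> to an invertible matrix \<open>M\<close> by a new first row whose product with \<open>v\<close> is
  \<open>1\<close>, so that \<open>M v\<close> is the first unit vector. Then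
  \<open>det M * det (v | W\<^sup>J) = det (M v | M W\<^sup>J) = det (B W\<^sup>J)\<close>,
  so that, up to the factor \<open>det M\<close>, the Pluecker coordinates of \<open>Y\<close> are the numbers
  \<open>det (v | W\<^sup>J)\<close> (\<open>maximal_minors_of_hyperplane\<close>). These depend linearly on \<open>v\<close>: they are the
  entries of the combination of the rows of \<open>V\<close> with coefficients \<open>v\<close>. As every nonzero \<open>v\<close> spans
  the kernel of a suitable \<open>B\<close>, the image of \<open>L(X\<^sup>S)\<close> is the whole projectivized row space of \<open>V\<close>
  (\<open>plucker_image_L\<close>).

  Its dimension is \<open>d\<close> because the rows of \<open>V\<close> are independent
  (\<open>independent_rows_hyperplane_minors\<close>): for \<open>J = C - {i}\<close> the matrix \<open>(v | W\<^sup>J)\<close> is the identity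
  with one column removed and \<open>v\<close> put in front, and its determinant is \<open>v\<^sub>i\<close> up to sign.
\<close>

section \<open>Row spaces and independent rows\<close>

text \<open>Independence is expressed through coefficient vectors instead of the set of rows, since a
  repeated row would disappear in a set.\<close>

definition independent_rows :: "'a::field mat \<Rightarrow> bool" where
  "independent_rows A \<longleftrightarrow>
     (\<forall>b \<in> carrier_vec (dim_row A). A\<^sup>T *\<^sub>v b = 0\<^sub>v (dim_col A) \<longrightarrow> b = 0\<^sub>v (dim_row A))"

lemma independent_rowsI:
  assumes "A \<in> carrier_mat k n"
    and "\<And>b. b \<in> carrier_vec k \<Longrightarrow> A\<^sup>T *\<^sub>v b = 0\<^sub>v n \<Longrightarrow> b = 0\<^sub>v k"
  shows "independent_rows A"
  using assms unfolding independent_rows_def by auto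

lemma independent_rowsD:
  assumes "independent_rows A" and "A \<in> carrier_mat k n"
    and "b \<in> carrier_vec k" and "A\<^sup>T *\<^sub>v b = 0\<^sub>v n"
  shows "b = 0\<^sub>v k"
  using assms unfolding independent_rows_def by auto

lemma mem_row_space_iff:
  fixes A :: "'a::field mat"
  assumes "A \<in> carrier_mat k n"
  shows "y \<in> vec_space.row_space n A \<longleftrightarrow> (\<exists>b \<in> carrier_vec k. y = A\<^sup>T *\<^sub>v b)"
proof -
  interpret vec_space "TYPE('a)" n .
  show ?thesis using assms unfolding row_space_eq[OF assms] by auto
qed

lemma mult_unit_vec:
  fixes A :: "'a::semiring_1 mat"
  assumes "A \<in> carrier_mat m k" and "i < k"
  shows "A *\<^sub>v unit_vec k i = col A i"
  using assms by (intro eq_vecI) auto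

lemma subspace_of_row_space:
  fixes A :: "'a::field mat"
  assumes A: "A \<in> carrier_mat k n"
  shows "subspace_of n (vec_space.row_space n A)"
proof -
  interpret vec_space "TYPE('a)" n .
  show ?thesis unfolding subspace_of_def row_space_def
    using A rows_carrier[of A] by (intro span_is_subspace) auto
qed

text \<open>Both directions go through the set of columns of the transpose, and each has to exclude repeated
  columns first: fewer than \<open>k\<close> distinct ones cannot span a \<open>k\<close>-dimensional space, and two equal
  ones are a dependency.\<close>
lemma subspace_dim_row_space_iff:
  fixes A :: "'a::field mat"
  assumes A: "A \<in> carrier_mat k n"
  shows "subspace_dim n (vec_space.row_space n A) = k \<longleftrightarrow> independent_rows A"
proof -
  interpret vec_space "TYPE('a)" n .
  have At: "A\<^sup>T \<in> carrier_mat n k" using A by simp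
  have rk: "subspace_dim n (row_space A) = rank A\<^sup>T"
    unfolding subspace_dim_def row_space_def rank_def by simp
  show ?thesis
  proof
    assume "subspace_dim n (row_space A) = k"
    hence r: "rank A\<^sup>T = k" using rk by simp
    obtain S where S: "maximal S (\<lambda>T. T \<subseteq> set (cols A\<^sup>T) \<and> lin_indpt T)"
      using maximal_exists[of "(\<lambda>T. T \<subseteq> set (cols A\<^sup>T) \<and> lin_indpt T)" "card (set (cols A\<^sup>T))" "{}"]
      by (meson List.finite_set card_mono empty_iff empty_subsetI finite_lin_indpt2 rev_finite_subset)
    have "k = card S" using rank_card_indpt[OF At S] r by simp
    moreover have "card S \<le> card (set (cols A\<^sup>T))" using S by (simp add: card_mono maximal_def)
    moreover have "length (cols A\<^sup>T) = k" using A by simp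
    ultimately have dist: "distinct (cols A\<^sup>T)"
      by (metis card_length card_distinct le_antisym)
    have li: "lin_indpt (set (cols A\<^sup>T))" by (rule full_rank_lin_indpt[OF At r dist])
    show "independent_rows A"
      by (rule independent_rowsI[OF A]) (use lin_depI[OF At _ _ _ dist] li in blast)
  next
    assume ind: "independent_rows A"
    \<comment> \<open>If the columns \<open>i\<close> and \<open>j\<close> agree, the difference of the two unit vectors is mapped to \<open>0\<close>.\<close>
    have dist: "distinct (cols A\<^sup>T)"
    proof (rule ccontr)
      assume "\<not> distinct (cols A\<^sup>T)"
      then obtain i j where ij: "i < k" "j < k" "i \<noteq> j" "col A\<^sup>T i = col A\<^sup>T j"
        unfolding distinct_conv_nth using A by auto
      have "A\<^sup>T *\<^sub>v (unit_vec k i - unit_vec k j) = A\<^sup>T *\<^sub>v unit_vec k i - A\<^sup>T *\<^sub>v unit_vec k j"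
        using At by (intro mult_minus_distrib_mat_vec) auto
      also have "\<dots> = col A\<^sup>T i - col A\<^sup>T j"
        using At ij by (simp add: mult_unit_vec)
      also have "\<dots> = 0\<^sub>v n" using ij At by auto
      finally have "unit_vec k i - unit_vec k j = (0\<^sub>v k :: 'a vec)"
        using independent_rowsD[OF ind A] by auto
      hence "(unit_vec k i - unit_vec k j) $ i = (0::'a)" using ij by simp
      thus False using ij by simp
    qed
    have "lin_indpt (set (cols A\<^sup>T))"
    proof
      assume "lin_dep (set (cols A\<^sup>T))"
      from lin_depE[OF At this dist] show False using independent_rowsD[OF ind A] by blast
    qed
    thus "subspace_dim n (row_space A) = k" using lin_indpt_full_rank[OF At dist] rk by simp
  qed
qed

text \<open>The rows are a maximal independent subset of \<open>Y\<close>. One exists, and is finite, because independent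
  sets in \<open>K\<^sup>n\<close> have at most \<open>n\<close> elements; a vector of \<open>Y\<close> outside its span would enlarge it.\<close>
lemma ex_matrix_row_space:
  fixes Y :: "'a::field vec set"
  assumes sub: "subspace_of n Y" and dim: "subspace_dim n Y = k"
  shows "\<exists>A \<in> carrier_mat k n. vec_space.row_space n A = Y"
proof -
  interpret vec_space "TYPE('a)" n .
  have subm: "submodule class_ring Y V" using sub unfolding subspace_of_def subspace_def by auto
  have YC: "Y \<subseteq> carrier_vec n" using subm unfolding submodule_def by auto
  obtain B where B: "finite B" "maximal B (\<lambda>T. T \<subseteq> Y \<and> lin_indpt T)"
  proof -
    have bound: "finite T \<and> card T \<le> dim" if "T \<subseteq> Y \<and> lin_indpt T" for T
      using li_le_dim[OF fin_dim, of T] that YC by auto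
    have "{} \<subseteq> Y \<and> lin_indpt {}" by (simp add: lin_dep_def)
    from maximal_exists[of "\<lambda>T. T \<subseteq> Y \<and> lin_indpt T", OF bound this] show ?thesis
      using that by blast
  qed
  have BY: "B \<subseteq> Y" and Bi: "lin_indpt B" using B(2) unfolding maximal_def by auto
  have BC: "B \<subseteq> carrier_vec n" using BY YC by auto
  have "span B \<subseteq> Y" using span_is_subset[OF BY subm] .
  moreover have "Y \<subseteq> span B"
  proof
    fix y assume y: "y \<in> Y"
    show "y \<in> span B"
    proof (cases "y \<in> B")
      case True thus ?thesis using in_own_span[OF BC] by auto
    next
      case False
      have "\<not> lin_indpt (B \<union> {y})"
        using B(2) False y BY unfolding maximal_def by auto
      thus ?thesis using lin_dep_iff_in_span[OF _ Bi _ False] BC y YC by auto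
    qed
  qed
  ultimately have spB: "span B = Y" by auto
  have "maximal B (\<lambda>T. T \<subseteq> B \<and> lin_indpt T)" using Bi unfolding maximal_def by auto
  from dim_span[OF _ B(1) this] BC have "card B = k"
    using dim unfolding subspace_dim_def spB by simp
  moreover obtain bs where bs: "set bs = B" "distinct bs" using finite_distinct_list[OF B(1)] by auto
  ultimately have len: "length bs = k" using distinct_card by metis
  have "rows (mat_of_rows n bs) = bs" using bs BC by auto
  hence "row_space (mat_of_rows n bs) = Y" unfolding row_space_def using bs spB by simp
  moreover have "mat_of_rows n bs \<in> carrier_mat k n" using len by auto
  ultimately show ?thesis by blast
qed

text \<open>The rows of \<open>B\<close> are the coefficients of the rows of \<open>A\<close> in terms of those of \<open>W\<close>. This turns
  every comparison of subspaces below into a matrix identity.\<close>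
lemma row_space_subset_iff_factor:
  fixes A W :: "'a::field mat"
  assumes A: "A \<in> carrier_mat k n" and W: "W \<in> carrier_mat m n"
  shows "vec_space.row_space n A \<subseteq> vec_space.row_space n W \<longleftrightarrow> (\<exists>B \<in> carrier_mat k m. A = B * W)"
proof
  assume sub: "vec_space.row_space n A \<subseteq> vec_space.row_space n W"
  have "\<exists>b \<in> carrier_vec m. row A i = W\<^sup>T *\<^sub>v b" if i: "i < k" for i
  proof -
    have "row A i = A\<^sup>T *\<^sub>v unit_vec k i" using A i by (simp add: mult_unit_vec)
    hence "row A i \<in> vec_space.row_space n A" using mem_row_space_iff[OF A] by auto
    thus ?thesis using sub mem_row_space_iff[OF W] by blast
  qed
  then obtain b where b: "\<And>i. i < k \<Longrightarrow> b i \<in> carrier_vec m"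
      "\<And>i. i < k \<Longrightarrow> row A i = W\<^sup>T *\<^sub>v b i" by metis
  define B where "B = mat k m (\<lambda>(i, j). b i $ j)"
  have rB: "row B i = b i" if "i < k" for i using b(1)[OF that] that unfolding B_def by auto
  have "A = B * W"
  proof (rule eq_matI)
    fix i j assume ij: "i < dim_row (B * W)" "j < dim_col (B * W)"
    hence i: "i < k" and j: "j < n" using W unfolding B_def by auto
    have "A $$ (i, j) = row A i $ j" using i j A by auto
    also have "\<dots> = col W j \<bullet> b i" using b(2)[OF i] W j by simp
    also have "\<dots> = b i \<bullet> col W j"
      using b(1)[OF i] W by (intro comm_scalar_prod[of _ m]) auto
    finally show "A $$ (i, j) = (B * W) $$ (i, j)" using rB[OF i] ij by simp
  qed (use A W in \<open>auto simp: B_def\<close>)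
  thus "\<exists>B \<in> carrier_mat k m. A = B * W" unfolding B_def by (metis mat_carrier)
next
  assume "\<exists>B \<in> carrier_mat k m. A = B * W"
  then obtain B where B: "B \<in> carrier_mat k m" "A = B * W" by auto
  show "vec_space.row_space n A \<subseteq> vec_space.row_space n W"
  proof
    fix y assume "y \<in> vec_space.row_space n A"
    then obtain b where b: "b \<in> carrier_vec k" "y = A\<^sup>T *\<^sub>v b" using mem_row_space_iff[OF A] by auto
    have "y = (W\<^sup>T * B\<^sup>T) *\<^sub>v b" using b B W transpose_mult by metis
    also have "\<dots> = W\<^sup>T *\<^sub>v (B\<^sup>T *\<^sub>v b)"
      using W B b by (intro assoc_mult_mat_vec[of _ n m _ k]) auto
    finally show "y \<in> vec_space.row_space n W"
      using mem_row_space_iff[OF W] B b by (metis mult_mat_vec_carrier transpose_carrier_mat)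
  qed
qed

lemma independent_rows_mult_iff:
  fixes B W :: "'a::field mat"
  assumes B: "B \<in> carrier_mat k m" and W: "W \<in> carrier_mat m n" and indW: "independent_rows W"
  shows "independent_rows (B * W) \<longleftrightarrow> independent_rows B"
proof -
  have eq: "(B * W)\<^sup>T *\<^sub>v b = W\<^sup>T *\<^sub>v (B\<^sup>T *\<^sub>v b)" if "b \<in> carrier_vec k" for b
    using B W that by (simp add: transpose_mult[OF B W] assoc_mult_mat_vec[of _ n m _ k])
  have BW: "B * W \<in> carrier_mat k n" using B W by auto
  show ?thesis
  proof
    assume ind: "independent_rows (B * W)"
    show "independent_rows B"
    proof (rule independent_rowsI[OF B])
      fix b assume b: "b \<in> carrier_vec k" "B\<^sup>T *\<^sub>v b = 0\<^sub>v m"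
      have "W\<^sup>T *\<^sub>v 0\<^sub>v m = 0\<^sub>v n" using W by auto
      with b eq show "b = 0\<^sub>v k" using independent_rowsD[OF ind BW] by simp
    qed
  next
    assume ind: "independent_rows B"
    show "independent_rows (B * W)"
    proof (rule independent_rowsI[OF BW])
      fix b assume b: "b \<in> carrier_vec k" "(B * W)\<^sup>T *\<^sub>v b = 0\<^sub>v n"
      have "B\<^sup>T *\<^sub>v b = 0\<^sub>v m"
        using independent_rowsD[OF indW W, of "B\<^sup>T *\<^sub>v b"] b eq B by auto
      thus "b = 0\<^sub>v k" using independent_rowsD[OF ind B] b by simp
    qed
  qed
qed

section \<open>Column selection\<close>

lemma columns_carrier:
  assumes "A \<in> carrier_mat k n" and "J \<subseteq> {0..<n}"
  shows "columns A J \<in> carrier_mat k (card J)"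
proof -
  have "{j. j < n \<and> j \<in> J} = J" using assms(2) by auto
  thus ?thesis using assms(1) unfolding columns_def
    by (intro carrier_matI) (simp_all add: dim_submatrix)
qed

lemma pick_less:
  assumes "J \<subseteq> {0..<n}" and "j < card J"
  shows "pick J j < n"
  using pick_in_set_le[OF assms(2)] assms(1) by auto

lemma columns_index:
  assumes "A \<in> carrier_mat k n" and "J \<subseteq> {0..<n}" and "i < k" and "j < card J"
  shows "columns A J $$ (i, j) = A $$ (i, pick J j)"
proof -
  have "{j. j < n \<and> j \<in> J} = J" using assms(2) by auto
  thus ?thesis using assms unfolding columns_def
    by (subst submatrix_index) (auto simp: pick_UNIV)
qed

lemma columns_mult:
  fixes B W :: "'a::field mat"
  assumes B: "B \<in> carrier_mat k m" and W: "W \<in> carrier_mat m n" and J: "J \<subseteq> {0..<n}"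
  shows "columns (B * W) J = B * columns W J"
proof (rule eq_matI)
  note cW = columns_carrier[OF W J] and cBW = columns_carrier[OF mult_carrier_mat[OF B W] J]
  fix i j assume "i < dim_row (B * columns W J)" "j < dim_col (B * columns W J)"
  hence i: "i < k" and j: "j < card J" using B cW by auto
  have "col (columns W J) j = col W (pick J j)"
    using cW W j pick_less[OF J j] by (intro eq_vecI) (auto simp: columns_index[OF W J])
  thus "columns (B * W) J $$ (i, j) = (B * columns W J) $$ (i, j)"
    using i j B W cW pick_less[OF J j] by (simp add: columns_index[OF mult_carrier_mat[OF B W] J])
qed (use columns_carrier[OF W J] columns_carrier[OF mult_carrier_mat[OF B W] J] B in auto)

section \<open>Determinants with a prepended column\<close>

lemma prepend_col_carrier:
  assumes "A \<in> carrier_mat m k"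
  shows "prepend_col v A \<in> carrier_mat m (k + 1)"
  using assms unfolding prepend_col_def by auto

lemma prepend_col_index:
  assumes "A \<in> carrier_mat m k" and "i < m" and "j < k + 1"
  shows "prepend_col v A $$ (i, j) = (if j = 0 then v $ i else A $$ (i, j - 1))"
  using assms unfolding prepend_col_def
  by (auto simp: mat_of_cols_index nth_Cons split: nat.splits)

lemma mult_prepend_col:
  fixes A M :: "'a::field mat"
  assumes M: "M \<in> carrier_mat m m" and A: "A \<in> carrier_mat m k" and v: "v \<in> carrier_vec m"
  shows "M * prepend_col v A = prepend_col (M *\<^sub>v v) (M * A)"
proof (rule eq_matI)
  note cP = prepend_col_carrier[OF A, of v]
  note cQ = prepend_col_carrier[OF mult_carrier_mat[OF M A], of "M *\<^sub>v v"]
  fix i j assume "i < dim_row (prepend_col (M *\<^sub>v v) (M * A))"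
    and "j < dim_col (prepend_col (M *\<^sub>v v) (M * A))"
  hence i: "i < m" and j: "j < k + 1" using cQ by auto
  have "col (prepend_col v A) j = (if j = 0 then v else col A (j - 1))"
    using cP A v j by (intro eq_vecI) (auto simp: prepend_col_index[OF A])
  thus "(M * prepend_col v A) $$ (i, j) = prepend_col (M *\<^sub>v v) (M * A) $$ (i, j)"
    using i j M A v cP by (auto simp: prepend_col_index[OF mult_carrier_mat[OF M A]])
qed (use prepend_col_carrier[OF A, of v] prepend_col_carrier[OF mult_carrier_mat[OF M A], of "M *\<^sub>v v"]
      M in auto)

text \<open>Laplace expansion along the prepended column. The cofactors do not involve that column, which is
  why a zero column can stand in for \<open>v\<close> on the right and the expression is visibly linear in \<open>v\<close>.\<close>
lemma det_prepend_col_expand: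
  fixes A :: "'a::field mat"
  assumes A: "A \<in> carrier_mat (k + 1) k"
  shows "det (prepend_col v A)
    = (\<Sum>i<k + 1. v $ i * ((-1) ^ i * det (mat_delete (prepend_col (0\<^sub>v (k + 1)) A) i 0)))"
proof -
  note cP = prepend_col_carrier[OF A]
  have del: "mat_delete (prepend_col v A) i 0 = mat_delete (prepend_col w A) i 0" for w i
    using cP[of v] cP[of w] by (intro eq_matI) (auto simp: mat_delete_def prepend_col_index[OF A])
  have "det (prepend_col v A)
      = (\<Sum>i<k + 1. prepend_col v A $$ (i, 0) * cofactor (prepend_col v A) i 0)"
    using laplace_expansion_column[OF cP] by simp
  thus ?thesis
    by (simp add: cofactor_def prepend_col_index[OF A] del[of _ "0\<^sub>v (k + 1)"])
qed

lemma det_prepend_col_eq_sum: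
  fixes A :: "'a::field mat"
  assumes A: "A \<in> carrier_mat (k + 1) k"
  shows "det (prepend_col v A) = (\<Sum>i<k + 1. v $ i * det (prepend_col (unit_vec (k + 1) i) A))"
proof -
  define c where "c i = (-1) ^ i * det (mat_delete (prepend_col (0\<^sub>v (k + 1)) A) i 0)" for i
  have ex: "det (prepend_col w A) = (\<Sum>i<k + 1. w $ i * c i)" for w
    unfolding c_def by (rule det_prepend_col_expand[OF A])
  have "det (prepend_col (unit_vec (k + 1) i) A) = c i" if i: "i < k + 1" for i
  proof -
    have "det (prepend_col (unit_vec (k + 1) i) A) = (\<Sum>j<k + 1. if j = i then c j else 0)"
      unfolding ex using i by (intro sum.cong) auto
    thus ?thesis using i by simp
  qed
  thus ?thesis unfolding ex[of v] by (intro sum.cong) auto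
qed

lemma det_prepend_first_unit_vec:
  fixes A :: "'a::field mat"
  assumes A: "A \<in> carrier_mat (k + 1) k"
  shows "det (prepend_col (unit_vec (k + 1) 0) A) = det (mat k k (\<lambda>(i, j). A $$ (i + 1, j)))"
proof -
  have "det (prepend_col (unit_vec (k + 1) 0) A)
      = (\<Sum>i<k + 1. if i = 0 then det (mat_delete (prepend_col (0\<^sub>v (k + 1)) A) 0 0) else 0)"
    unfolding det_prepend_col_expand[OF A] by (intro sum.cong) auto
  also have "\<dots> = det (mat_delete (prepend_col (0\<^sub>v (k + 1)) A) 0 0)" by simp
  also have "mat_delete (prepend_col (0\<^sub>v (k + 1)) A) 0 0 = mat k k (\<lambda>(i, j). A $$ (i + 1, j))"
    using prepend_col_carrier[OF A, of "0\<^sub>v (k + 1)"]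
    by (intro eq_matI) (auto simp: mat_delete_def prepend_col_index[OF A])
  finally show ?thesis .
qed

text \<open>A variant of the Cauchy-Binet formula for corank one. The factor \<open>c\<close> is \<open>det M\<close>, where \<open>M\<close> is
  \<open>B\<close> with an additional first row whose product with \<open>v\<close> is \<open>1\<close>. The essential point is that \<open>c\<close>
  does not depend on \<open>J\<close>.\<close>
lemma maximal_minors_of_hyperplane:
  fixes B W :: "'a::field mat"
  assumes B: "B \<in> carrier_mat k (k + 1)" and indB: "independent_rows B"
    and v: "v \<in> carrier_vec (k + 1)" "v \<noteq> 0\<^sub>v (k + 1)" and Bv: "B *\<^sub>v v = 0\<^sub>v k"
    and W: "W \<in> carrier_mat (k + 1) n"
  shows "\<exists>c. c \<noteq> 0 \<and> (\<forall>J \<subseteq> {0..<n}. card J = k \<longrightarrow>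
           det (columns (B * W) J) = c * det (prepend_col v (columns W J)))"
proof -
  obtain l where l: "l < k + 1" "v $ l \<noteq> 0"
    using v by (metis carrier_vecD eq_vecI index_zero_vec)
  define M where "M = mat (k + 1) (k + 1)
    (\<lambda>(i, j). if i = 0 then (if j = l then inverse (v $ l) else 0) else B $$ (i - 1, j))"
  have M: "M \<in> carrier_mat (k + 1) (k + 1)" unfolding M_def by simp
  have row0: "row M 0 = inverse (v $ l) \<cdot>\<^sub>v unit_vec (k + 1) l"
    by (intro eq_vecI) (auto simp: M_def unit_vec_def)
  have rowS: "row M (Suc i) = row B i" if "i < k" for i
    using that B by (intro eq_vecI) (auto simp: M_def)
  have Mv: "M *\<^sub>v v = unit_vec (k + 1) 0"
  proof (rule eq_vecI)
    fix i assume "i < dim_vec (unit_vec (k + 1) 0 :: 'a vec)"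
    hence i: "i < k + 1" by simp
    show "(M *\<^sub>v v) $ i = unit_vec (k + 1) 0 $ i"
    proof (cases i)
      case 0
      thus ?thesis using M row0 l v by simp
    next
      case (Suc r)
      have "(B *\<^sub>v v) $ r = 0" using Bv Suc i by simp
      thus ?thesis using M rowS[of r] Suc i B by simp
    qed
  qed (use M in auto)
  \<comment> \<open>Pair a dependency \<open>b\<close> among the rows of \<open>M\<close> with \<open>v\<close>: as \<open>M v\<close> is the first unit vector, the
    coefficient of the first row vanishes, and a dependency among the rows of \<open>B\<close> remains.\<close>
  have "det M \<noteq> 0"
  proof
    assume "det M = 0"
    hence "det M\<^sup>T = 0" using det_transpose[OF M] by simp
    then obtain b where b: "b \<in> carrier_vec (k + 1)" "b \<noteq> 0\<^sub>v (k + 1)"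
      "M\<^sup>T *\<^sub>v b = 0\<^sub>v (k + 1)"
      using det_0_iff_vec_prod_zero_field[of "M\<^sup>T" "k + 1"] M by auto
    have "0 = (M\<^sup>T *\<^sub>v b) \<bullet> v" using b v by simp
    also have "\<dots> = b \<bullet> (M *\<^sub>v v)"
      using transpose_vec_mult_scalar[OF M v(1) b(1)] by simp
    also have "\<dots> = b $ 0" unfolding Mv using b by simp
    finally have b0: "b $ 0 = 0" by simp
    define b' where "b' = vec k (\<lambda>i. b $ Suc i)"
    have "B\<^sup>T *\<^sub>v b' = M\<^sup>T *\<^sub>v b"
    proof (rule eq_vecI)
      fix j assume "j < dim_vec (M\<^sup>T *\<^sub>v b)"
      hence j: "j < k + 1" using M by simp
      have "(M\<^sup>T *\<^sub>v b) $ j = (\<Sum>i = 0..<Suc k. M $$ (i, j) * b $ i)"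
        using M b(1) j by (simp add: scalar_prod_def del: sum.op_ivl_Suc)
      also have "\<dots> = (\<Sum>i = 0..<k. M $$ (Suc i, j) * b $ Suc i)"
        unfolding sum.atLeast0_lessThan_Suc_shift using b0 by simp
      also have "\<dots> = (\<Sum>i = 0..<k. B $$ (i, j) * b $ Suc i)"
        using j by (intro sum.cong) (auto simp: M_def)
      also have "\<dots> = (B\<^sup>T *\<^sub>v b') $ j"
        using B j by (simp add: scalar_prod_def b'_def)
      finally show "(B\<^sup>T *\<^sub>v b') $ j = (M\<^sup>T *\<^sub>v b) $ j" by simp
    qed (use B M in auto)
    hence "b' = 0\<^sub>v k"
      using independent_rowsD[OF indB B, of b'] b by (simp add: b'_def)
    hence "b $ Suc i = 0" if "i < k" for i
      using that unfolding b'_def by (metis index_vec index_zero_vec(1))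
    hence "b = 0\<^sub>v (k + 1)"
      using b(1) b0 by (intro eq_vecI) (auto simp: less_Suc_eq_0_disj)
    thus False using b by simp
  qed
  moreover have "det (columns (B * W) J) = det M * det (prepend_col v (columns W J))"
    if J: "J \<subseteq> {0..<n}" "card J = k" for J
  proof -
    have cW: "columns W J \<in> carrier_mat (k + 1) k" using columns_carrier[OF W J(1)] J by simp
    have cP: "prepend_col v (columns W J) \<in> carrier_mat (k + 1) (k + 1)"
      by (rule prepend_col_carrier[OF cW])
    have MW: "M * columns W J \<in> carrier_mat (k + 1) k" using M cW by simp
    have "det M * det (prepend_col v (columns W J)) = det (M * prepend_col v (columns W J))"
      using det_mult[OF M cP] by simp
    also have "\<dots> = det (mat k k (\<lambda>(i, j). (M * columns W J) $$ (i + 1, j)))"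
      unfolding mult_prepend_col[OF M cW v(1)] Mv by (rule det_prepend_first_unit_vec[OF MW])
    also have "mat k k (\<lambda>(i, j). (M * columns W J) $$ (i + 1, j)) = B * columns W J"
      using M cW B rowS by (intro eq_matI) auto
    finally show ?thesis using columns_mult[OF B W J(1)] by simp
  qed
  ultimately show ?thesis by blast
qed

section \<open>The matrix of a linear space of hyperplanes\<close>

lemma set_k_subsets: "set (k_subsets n k) = {J. J \<subseteq> {0..<n} \<and> card J = k}"
proof -
  have len: "length xs = card (set xs)" if "xs \<in> set (subseqs [0..<n])" for xs
    using subseqs_distinctD[OF that] distinct_card by fastforce
  have "set (k_subsets n k) = {J \<in> set ` set (subseqs [0..<n]). card J = k}"
    unfolding k_subsets_def using len by auto
  thus ?thesis unfolding subseqs_powset by auto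
qed

lemma length_k_subsets: "length (k_subsets n k) = n choose k"
proof -
  have "distinct (map set (subseqs [0..<n]))" by (rule distinct_set_subseqs) simp
  hence "distinct (k_subsets n k)" unfolding k_subsets_def by (simp add: distinct_map_filter)
  hence "length (k_subsets n k) = card {J. J \<subseteq> {0..<n} \<and> card J = k}"
    using distinct_card set_k_subsets by metis
  thus ?thesis by (simp add: n_subsets)
qed

lemma k_subsets_nth:
  assumes "j < n choose k"
  shows "k_subsets n k ! j \<subseteq> {0..<n}" and "card (k_subsets n k ! j) = k"
  using assms set_k_subsets[of n k] nth_mem[of j "k_subsets n k"] length_k_subsets[of n k] by auto

text \<open>For a matrix \<open>W\<close> whose rows form a basis, the row space of this matrix is the linear span of the
  Pluecker points of the hyperplanes of the row space of \<open>W\<close>. The matrix \<open>V_S\<close> is the special case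
  \<open>W = W_S\<close>.\<close>
definition hyperplane_minors :: "nat \<Rightarrow> nat \<Rightarrow> 'a::field mat \<Rightarrow> 'a mat" where
  "hyperplane_minors d n W = mat (d + 1) (n choose d)
     (\<lambda>(i, j). det (prepend_col (unit_vec (d + 1) i) (columns W (k_subsets n d ! j))))"

lemma hyperplane_minors_carrier: "hyperplane_minors d n W \<in> carrier_mat (d + 1) (n choose d)"
  unfolding hyperplane_minors_def by simp

lemma hyperplane_minors_combination:
  fixes W :: "'a::field mat"
  assumes W: "W \<in> carrier_mat (d + 1) n" and v: "v \<in> carrier_vec (d + 1)"
  shows "(hyperplane_minors d n W)\<^sup>T *\<^sub>v v
    = vec (n choose d) (\<lambda>j. det (prepend_col v (columns W (k_subsets n d ! j))))"
proof (rule eq_vecI)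
  fix j
  assume "j < dim_vec (vec (n choose d)
    (\<lambda>j. det (prepend_col v (columns W (k_subsets n d ! j)))))"
  hence j: "j < n choose d" by simp
  have cW: "columns W (k_subsets n d ! j) \<in> carrier_mat (d + 1) d"
    using columns_carrier[OF W k_subsets_nth(1)[OF j]] k_subsets_nth(2)[OF j] by simp
  show "((hyperplane_minors d n W)\<^sup>T *\<^sub>v v) $ j
      = vec (n choose d) (\<lambda>j. det (prepend_col v (columns W (k_subsets n d ! j)))) $ j"
    using j v det_prepend_col_eq_sum[OF cW, of v]
    by (simp add: hyperplane_minors_def scalar_prod_def atLeast0LessThan mult.commute
        del: sum.lessThan_Suc)
qed (simp add: hyperplane_minors_def)

lemma pick_eq_iff:
  assumes "i < card C" and "j < card C"
  shows "pick C i = pick C j \<longleftrightarrow> i = j"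
  using assms pick_mono_le[of i C j] pick_mono_le[of j C i] by (metis less_irrefl nat_neq_iff)

lemma ex_pick:
  assumes "finite C" and "x \<in> C"
  shows "\<exists>l < card C. pick C l = x"
proof (intro exI conjI)
  show "card {a \<in> C. a < x} < card C" using assms by (intro psubset_card_mono) auto
  show "pick C (card {a \<in> C. a < x}) = x" by (rule pick_card_in_set[OF assms(2)])
qed

text \<open>Deleting the element at position \<open>k\<close> shifts the later positions down by one, exactly as
  deleting a column does in a cofactor.\<close>
lemma pick_remove:
  assumes C: "finite C" and k: "k < card C" and j: "j < card C - 1"
  shows "pick (C - {pick C k}) j = pick C (if j < k then j else Suc j)"
proof -
  define l where "l = (if j < k then j else Suc j)"
  have l: "l < card C" "l \<noteq> k" using k j unfolding l_def by auto
  have mem: "pick C l \<in> C - {pick C k}"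
    using pick_in_set_le[OF l(1)] pick_eq_iff[OF l(1) k] l(2) by auto
  have cl: "card {a \<in> C. a < pick C l} = l" by (rule card_pick_le[OF l(1)])
  have "card {a \<in> C - {pick C k}. a < pick C l} = j"
  proof (cases "j < k")
    case True
    hence "pick C l < pick C k" using pick_mono_le[of k C l] k unfolding l_def by auto
    hence "{a \<in> C - {pick C k}. a < pick C l} = {a \<in> C. a < pick C l}" by auto
    thus ?thesis using cl True unfolding l_def by simp
  next
    case False
    hence "pick C k < pick C l" using pick_mono_le[of l C k] l unfolding l_def by auto
    hence "{a \<in> C. a < pick C l} = insert (pick C k) {a \<in> C - {pick C k}. a < pick C l}"
      using pick_in_set_le[OF k] by auto
    moreover have "card (insert (pick C k) {a \<in> C - {pick C k}. a < pick C l})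
        = Suc (card {a \<in> C - {pick C k}. a < pick C l})"
      using C by (intro card_insert_disjoint) auto
    ultimately have "l = Suc (card {a \<in> C - {pick C k}. a < pick C l})" using cl by simp
    thus ?thesis using False unfolding l_def by simp
  qed
  thus ?thesis using pick_card_in_set[OF mem] unfolding l_def by simp
qed

text \<open>Columns forming the identity matrix recover the coefficients of a combination of the rows.\<close>
lemma pivot_coordinates:
  fixes W :: "'a::field mat"
  assumes W: "W \<in> carrier_mat m n" and C: "C \<subseteq> {0..<n}" "card C = m"
    and WC: "columns W C = 1\<^sub>m m"
    and b: "b \<in> carrier_vec m" and k: "k < m"
  shows "(W\<^sup>T *\<^sub>v b) $ pick C k = b $ k"
proof -
  have lt: "pick C k < n" using pick_less[OF C(1)] C(2) k by simp
  have "col W (pick C k) = unit_vec m k"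
  proof (rule eq_vecI)
    fix i assume "i < dim_vec (unit_vec m k :: 'a vec)"
    hence i: "i < m" by simp
    have "W $$ (i, pick C k) = columns W C $$ (i, k)"
      using columns_index[OF W C(1) i] C(2) k by simp
    thus "col W (pick C k) $ i = unit_vec m k $ i" using i k W lt unfolding WC by simp
  qed (use W in auto)
  thus ?thesis using W b k lt by simp
qed

lemma independent_rows_pivots:
  fixes W :: "'a::field mat"
  assumes W: "W \<in> carrier_mat m n" and C: "C \<subseteq> {0..<n}" "card C = m"
    and WC: "columns W C = 1\<^sub>m m"
  shows "independent_rows W"
proof (rule independent_rowsI[OF W])
  fix b assume b: "b \<in> carrier_vec m" "W\<^sup>T *\<^sub>v b = 0\<^sub>v n"
  show "b = 0\<^sub>v m"
  proof (rule eq_vecI)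
    fix k assume "k < dim_vec (0\<^sub>v m :: 'a vec)"
    hence k: "k < m" by simp
    thus "b $ k = 0\<^sub>v m $ k"
      using pivot_coordinates[OF W C WC b(1) k] b(2) pick_less[OF C(1)] C(2) by simp
  qed (use b in auto)
qed

text \<open>A combination of the rows with coefficients \<open>v\<close> has the entry \<open>det (v | W\<^sup>J)\<close> at \<open>J\<close>. For
  \<open>J = C - {i}\<close>, where \<open>i\<close> is the element of \<open>C\<close> at position \<open>k\<close>, row \<open>k\<close> of \<open>(v | W\<^sup>J)\<close> vanishes
  except for its first entry \<open>v $ k\<close>, and the complementary minor is an identity matrix. So the entry
  at \<open>J\<close> isolates one coefficient of \<open>v\<close>, up to sign.\<close>
lemma independent_rows_hyperplane_minors:
  fixes W :: "'a::field mat"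
  assumes W: "W \<in> carrier_mat (d + 1) n" and C: "C \<subseteq> {0..<n}" "card C = d + 1"
    and WC: "columns W C = 1\<^sub>m (d + 1)"
  shows "independent_rows (hyperplane_minors d n W)"
proof (rule independent_rowsI[OF hyperplane_minors_carrier])
  fix v :: "'a vec"
  assume v: "v \<in> carrier_vec (d + 1)"
    and z: "(hyperplane_minors d n W)\<^sup>T *\<^sub>v v = 0\<^sub>v (n choose d)"
  have finC: "finite C" using C(1) finite_subset by blast
  have "v $ k = 0" if k: "k < d + 1" for k
  proof -
    define J where "J = C - {pick C k}"
    have kC: "k < card C" using k C by simp
    have JC: "J \<subseteq> {0..<n}" "card J = d"
      unfolding J_def using C finC pick_in_set_le[OF kC] by auto
    hence "J \<in> set (k_subsets n d)" unfolding set_k_subsets by blast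
    then obtain j where "j < n choose d" "k_subsets n d ! j = J"
      unfolding in_set_conv_nth length_k_subsets by blast
    hence det0: "det (prepend_col v (columns W J)) = 0"
      using arg_cong[OF z, of "\<lambda>u. u $ j"] unfolding hyperplane_minors_combination[OF W v] by simp
    define P where "P = prepend_col v (columns W J)"
    have cW: "columns W J \<in> carrier_mat (d + 1) d" using columns_carrier[OF W JC(1)] JC(2) by simp
    have P: "P \<in> carrier_mat (d + 1) (d + 1)" unfolding P_def by (rule prepend_col_carrier[OF cW])
    have P0: "P $$ (k, 0) = v $ k" unfolding P_def using prepend_col_index[OF cW k] by simp
    have PS: "P $$ (i, Suc j) = (if i = (if j < k then j else Suc j) then 1 else 0)"
      if i: "i < d + 1" and j: "j < d" for i j
    proof -
      have l: "(if j < k then j else Suc j) < d + 1" using j by auto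
      have "P $$ (i, Suc j) = W $$ (i, pick C (if j < k then j else Suc j))"
        unfolding P_def
        using prepend_col_index[OF cW i, of "Suc j"] columns_index[OF W JC(1) i] JC(2) j
          pick_remove[OF finC kC, of j] C(2) by (simp add: J_def)
      also have "\<dots> = columns W C $$ (i, if j < k then j else Suc j)"
        using columns_index[OF W C(1) i] C(2) l by metis
      finally show ?thesis unfolding WC using i l by simp
    qed
    have del: "mat_delete P k 0 = 1\<^sub>m d"
      using P by (intro eq_matI) (auto simp: mat_delete_def PS)
    have "det P = (\<Sum>j<d + 1. P $$ (k, j) * cofactor P k j)"
      by (rule laplace_expansion_row[OF P k])
    also have "\<dots> = (\<Sum>j<d + 1. if j = 0 then v $ k * cofactor P k 0 else 0)"
    proof (rule sum.cong[OF refl])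
      fix j assume j: "j \<in> {..<d + 1}"
      show "P $$ (k, j) * cofactor P k j = (if j = 0 then v $ k * cofactor P k 0 else 0)"
      proof (cases j)
        case (Suc r)
        thus ?thesis using PS[OF k, of r] j by simp
      qed (simp add: P0)
    qed
    also have "\<dots> = v $ k * (-1) ^ k" by (simp add: cofactor_def del)
    finally show ?thesis using det0 unfolding P_def by simp
  qed
  thus "v = 0\<^sub>v (d + 1)" using v by (intro eq_vecI) auto
qed

section \<open>Pluecker points of hyperplanes\<close>

text \<open>Padding \<open>B\<close> with a zero row makes it a singular square matrix with the same kernel.\<close>
lemma ex_kernel_vector:
  fixes B :: "'a::field mat"
  assumes B: "B \<in> carrier_mat k (k + 1)"
  shows "\<exists>v \<in> carrier_vec (k + 1). v \<noteq> 0\<^sub>v (k + 1) \<and> B *\<^sub>v v = 0\<^sub>v k"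
proof -
  define M where "M = mat (k + 1) (k + 1) (\<lambda>(i, j). if i = k then 0 else B $$ (i, j))"
  have M: "M \<in> carrier_mat (k + 1) (k + 1)" unfolding M_def by simp
  have "M\<^sup>T *\<^sub>v unit_vec (k + 1) k = 0\<^sub>v (k + 1)"
    using M by (subst mult_unit_vec[of _ "k + 1"]) (auto simp: M_def)
  hence "det M\<^sup>T = 0"
    using det_0_iff_vec_prod_zero_field[of "M\<^sup>T" "k + 1"] M
    by (metis lessI Suc_eq_plus1 transpose_carrier_mat unit_vec_carrier unit_vec_nonzero)
  hence "det M = 0" using det_transpose[OF M] by simp
  then obtain v where v: "v \<in> carrier_vec (k + 1)" "v \<noteq> 0\<^sub>v (k + 1)" "M *\<^sub>v v = 0\<^sub>v (k + 1)"
    using det_0_iff_vec_prod_zero_field[OF M] by auto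
  have "B *\<^sub>v v = 0\<^sub>v k"
  proof (rule eq_vecI)
    fix i assume "i < dim_vec (0\<^sub>v k :: 'a vec)"
    hence i: "i < k" by simp
    have "row M i = row B i" using i B by (intro eq_vecI) (auto simp: M_def)
    moreover have "(M *\<^sub>v v) $ i = 0" using v(3) i by simp
    ultimately show "(B *\<^sub>v v) $ i = 0\<^sub>v k $ i" using i B M by simp
  qed (use B in auto)
  thus ?thesis using v by blast
qed

text \<open>If \<open>v\<close> has a nonzero entry at \<open>l\<close>, then the functionals \<open>x \<mapsto> x\<^sub>i - (v\<^sub>i / v\<^sub>l) x\<^sub>l\<close> for \<open>i \<noteq> l\<close>
  form a basis of those vanishing at \<open>v\<close>; the function \<open>f\<close> in the proof enumerates the \<open>i\<close>.\<close>
lemma ex_matrix_with_kernel_vector: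
  fixes v :: "'a::field vec"
  assumes v: "v \<in> carrier_vec (k + 1)" "v \<noteq> 0\<^sub>v (k + 1)"
  shows "\<exists>B \<in> carrier_mat k (k + 1). independent_rows B \<and> B *\<^sub>v v = 0\<^sub>v k"
proof -
  obtain l where l: "l < k + 1" "v $ l \<noteq> 0"
    using v by (metis carrier_vecD eq_vecI index_zero_vec)
  define f where "f r = (if r < l then r else Suc r)" for r
  have f: "f r < k + 1" "f r \<noteq> l" if "r < k" for r using that unfolding f_def by auto
  have f_inj: "f r = f s \<longleftrightarrow> r = s" for r s unfolding f_def by auto
  define B where "B = mat k (k + 1)
    (\<lambda>(r, j). if j = f r then 1 else if j = l then - v $ f r / v $ l else 0)"
  have B: "B \<in> carrier_mat k (k + 1)" unfolding B_def by simp
  have "independent_rows B"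
  proof (rule independent_rowsI[OF B])
    fix b :: "'a vec" assume b: "b \<in> carrier_vec k" "B\<^sup>T *\<^sub>v b = 0\<^sub>v (k + 1)"
    have "b $ r = 0" if r: "r < k" for r
    proof -
      have "col B (f r) = unit_vec k r"
        using f[OF r] r by (intro eq_vecI) (auto simp: B_def f_inj unit_vec_def)
      hence "(B\<^sup>T *\<^sub>v b) $ f r = b $ r" using B b(1) f(1)[OF r] r by simp
      thus ?thesis using b(2) f(1)[OF r] by simp
    qed
    thus "b = 0\<^sub>v k" using b by (intro eq_vecI) auto
  qed
  moreover have "B *\<^sub>v v = 0\<^sub>v k"
  proof (rule eq_vecI)
    fix r assume "r < dim_vec (0\<^sub>v k :: 'a vec)"
    hence r: "r < k" by simp
    have "row B r = unit_vec (k + 1) (f r) + (- v $ f r / v $ l) \<cdot>\<^sub>v unit_vec (k + 1) l"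
      using f[OF r] r by (intro eq_vecI) (auto simp: B_def unit_vec_def)
    hence "(B *\<^sub>v v) $ r
        = (unit_vec (k + 1) (f r) + (- v $ f r / v $ l) \<cdot>\<^sub>v unit_vec (k + 1) l) \<bullet> v"
      using B r by simp
    also have "\<dots> = unit_vec (k + 1) (f r) \<bullet> v
        + (- v $ f r / v $ l) * (unit_vec (k + 1) l \<bullet> v)"
      using v by (subst add_scalar_prod_distrib[of _ "k + 1"]) auto
    also have "\<dots> = 0" using v l f[OF r] by simp
    finally show "(B *\<^sub>v v) $ r = 0\<^sub>v k $ r" using r by simp
  qed (use B in auto)
  ultimately show ?thesis using B by blast
qed

lemma grassmannian_carrier:
  assumes "(Y :: 'a::field vec set) \<in> grassmannian d n"
  shows "Y \<subseteq> carrier_vec n"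
proof -
  interpret vec_space "TYPE('a)" n .
  have "submodule class_ring Y V"
    using assms unfolding grassmannian_def subspace_of_def subspace_def by auto
  thus ?thesis unfolding submodule_def by auto
qed

lemma mem_L_iff:
  fixes X :: "'a::field vec set"
  shows "Y \<in> L d n X \<longleftrightarrow> Y \<in> grassmannian d n \<and> Y \<subseteq> X"
proof -
  have pr_id: "pr n {} y = y" if "y \<in> carrier_vec n" for y :: "'a vec"
    using that unfolding pr_def by (intro eq_vecI) auto
  have "pr n {} ` Y = Y" if "Y \<in> grassmannian d n"
    using grassmannian_carrier[OF that] pr_id by force
  thus ?thesis unfolding L_def LS_def by auto
qed

lemma span_of_nonzero_multiples:
  fixes u :: "'a::field vec"
  assumes u: "u \<in> carrier_vec N" and Q: "\<And>w. w \<in> Q \<Longrightarrow> \<exists>c. w = c \<cdot>\<^sub>v u"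
    and c: "c \<noteq> 0" "c \<cdot>\<^sub>v u \<in> Q"
  shows "span_of N Q = span_of N {u}"
proof -
  interpret vec_space "TYPE('a)" N .
  have QC: "Q \<subseteq> carrier_vec N" using Q u by fastforce
  have uu: "u \<in> span {u}" using u by (intro span_mem) auto
  have "Q \<subseteq> span {u}" 
  proof
    fix w assume "w \<in> Q"
    then obtain a where "w = a \<cdot>\<^sub>v u" using Q by blast
    thus "w \<in> span {u}" using smult_in_span[OF _ uu] u by auto
  qed
  moreover have "u \<in> span Q"
  proof -
    have "c \<cdot>\<^sub>v u \<in> span Q" using span_mem[of Q] QC c(2) by auto
    hence "inverse c \<cdot>\<^sub>v (c \<cdot>\<^sub>v u) \<in> span Q" by (rule smult_in_span[OF QC])
    thus ?thesis using c(1) u by (simp add: smult_smult_assoc)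
  qed
  ultimately show ?thesis
    using span_subsetI[of "{u}" Q] span_subsetI[of Q "{u}"] u QC by auto
qed

text \<open>The Pluecker point is defined through all matrices with the given row space, so the choice of \<open>B\<close>
  has to be shown immaterial: another such matrix is \<open>G B W\<close> for some \<open>G\<close>, and \<open>G B\<close> kills the same
  \<open>v\<close>, hence has minors proportional to the same numbers \<open>det (v | W\<^sup>J)\<close>.\<close>
lemma plucker_embedding_hyperplane:
  fixes B W :: "'a::field mat"
  assumes B: "B \<in> carrier_mat d (d + 1)" and indB: "independent_rows B"
    and v: "v \<in> carrier_vec (d + 1)" "v \<noteq> 0\<^sub>v (d + 1)" and Bv: "B *\<^sub>v v = 0\<^sub>v d"
    and W: "W \<in> carrier_mat (d + 1) n" and indW: "independent_rows W"
  shows "plucker_embedding n d (vec_space.row_space n (B * W))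
    = span_of (n choose d) {(hyperplane_minors d n W)\<^sup>T *\<^sub>v v}"
proof -
  let ?u = "(hyperplane_minors d n W)\<^sup>T *\<^sub>v v"
  have u: "?u \<in> carrier_vec (n choose d)" using hyperplane_minors_carrier[of d n W] v by auto
  have BW: "B * W \<in> carrier_mat d n" using B W by simp
  have indBW: "independent_rows (B * W)" using independent_rows_mult_iff[OF B W indW] indB by simp
  note dim = subspace_dim_row_space_iff
  have multiple: "\<exists>c. vec (n choose d) (\<lambda>j. q (k_subsets n d ! j)) = c \<cdot>\<^sub>v ?u"
    if q: "plucker_coords n d (vec_space.row_space n (B * W)) q" for q
  proof -
    obtain A c where A: "A \<in> carrier_mat d n"
      and rs: "vec_space.row_space n A = vec_space.row_space n (B * W)"
      and qA: "\<forall>J \<subseteq> {0..<n}. card J = d \<longrightarrow> q J = c * det (columns A J)"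
      using q unfolding plucker_coords_def by blast
    obtain G where G: "G \<in> carrier_mat d d" "A = G * (B * W)"
      using row_space_subset_iff_factor[OF A BW] rs by auto
    have GB: "G * B \<in> carrier_mat d (d + 1)" using G B by simp
    have A_eq: "A = (G * B) * W" using G B W by simp
    have "independent_rows A" using dim[OF A] dim[OF BW] rs indBW by simp
    hence indGB: "independent_rows (G * B)"
      using independent_rows_mult_iff[OF GB W indW] A_eq by simp
    have "(G * B) *\<^sub>v v = G *\<^sub>v (B *\<^sub>v v)" using G B v by simp
    also have "\<dots> = 0\<^sub>v d" unfolding Bv using G by auto
    finally obtain e where "\<forall>J \<subseteq> {0..<n}. card J = d \<longrightarrow>
        det (columns A J) = e * det (prepend_col v (columns W J))"
      using maximal_minors_of_hyperplane[OF GB indGB v _ W] A_eq by auto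
    hence "vec (n choose d) (\<lambda>j. q (k_subsets n d ! j)) = (c * e) \<cdot>\<^sub>v ?u"
      unfolding hyperplane_minors_combination[OF W v(1)] using qA k_subsets_nth[of _ n d]
      by (intro eq_vecI) auto
    thus ?thesis ..
  qed
  obtain e where e: "e \<noteq> 0" "\<forall>J \<subseteq> {0..<n}. card J = d \<longrightarrow>
        det (columns (B * W) J) = e * det (prepend_col v (columns W J))"
    using maximal_minors_of_hyperplane[OF B indB v Bv W] by auto
  have "plucker_coords n d (vec_space.row_space n (B * W)) (\<lambda>J. det (columns (B * W) J))"
    unfolding plucker_coords_def using BW by (metis mult_1 zero_neq_one)
  moreover have "vec (n choose d) (\<lambda>j. det (columns (B * W) (k_subsets n d ! j))) = e \<cdot>\<^sub>v ?u"
    unfolding hyperplane_minors_combination[OF W v(1)] using e k_subsets_nth[of _ n d]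
    by (intro eq_vecI) auto
  ultimately have mem: "e \<cdot>\<^sub>v ?u \<in> {vec (n choose d) (\<lambda>j. q (k_subsets n d ! j)) | q.
      plucker_coords n d (vec_space.row_space n (B * W)) q}"
    by (intro CollectI exI[of _ "\<lambda>J. det (columns (B * W) J)"]) simp
  show ?thesis unfolding plucker_embedding_def
    by (rule span_of_nonzero_multiples[OF u _ e(1) mem]) (use multiple in auto)
qed

text \<open>Hyperplanes of the row space of \<open>W\<close> correspond to nonzero vectors \<open>v\<close> up to scaling: a
  factorization \<open>A = B W\<close> of a basis matrix yields \<open>v\<close> in the kernel of \<open>B\<close>, and every \<open>v\<close> arises.
  Independence of the rows of \<open>hyperplane_minors\<close> ensures that \<open>v \<noteq> 0\<close> gives an actual projective
  point.\<close>
lemma plucker_image_L: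
  fixes W :: "'a::field mat"
  assumes W: "W \<in> carrier_mat (d + 1) n" and indW: "independent_rows W"
    and indV: "independent_rows (hyperplane_minors d n W)"
  shows "plucker_embedding n d ` L d n (vec_space.row_space n W)
    = projectivization (n choose d) (vec_space.row_space (n choose d) (hyperplane_minors d n W))"
    (is "?lhs = ?rhs")
proof
  note V = hyperplane_minors_carrier[of d n W]
  show "?lhs \<subseteq> ?rhs"
  proof
    fix p assume "p \<in> ?lhs"
    then obtain Y where Y: "Y \<in> grassmannian d n" "Y \<subseteq> vec_space.row_space n W"
      and p: "p = plucker_embedding n d Y" by (auto simp: mem_L_iff)
    then obtain A where A: "A \<in> carrier_mat d n" "vec_space.row_space n A = Y"
      using ex_matrix_row_space unfolding grassmannian_def by blast
    then obtain B where B: "B \<in> carrier_mat d (d + 1)" "A = B * W"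
      using row_space_subset_iff_factor[OF A(1) W] Y(2) by auto
    have "independent_rows A"
      using subspace_dim_row_space_iff[OF A(1)] A(2) Y(1) unfolding grassmannian_def by simp
    hence indB: "independent_rows B" using independent_rows_mult_iff[OF B(1) W indW] B(2) by simp
    obtain v where v: "v \<in> carrier_vec (d + 1)" "v \<noteq> 0\<^sub>v (d + 1)" "B *\<^sub>v v = 0\<^sub>v d"
      using ex_kernel_vector[OF B(1)] by blast
    have "p = span_of (n choose d) {(hyperplane_minors d n W)\<^sup>T *\<^sub>v v}"
      using plucker_embedding_hyperplane[OF B(1) indB v W indW] p A(2) B(2) by simp
    moreover have "(hyperplane_minors d n W)\<^sup>T *\<^sub>v v \<noteq> 0\<^sub>v (n choose d)"
      using independent_rowsD[OF indV V v(1)] v(2) by blast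
    moreover have "(hyperplane_minors d n W)\<^sup>T *\<^sub>v v
        \<in> vec_space.row_space (n choose d) (hyperplane_minors d n W)"
      using mem_row_space_iff[OF V] v(1) by auto
    ultimately show "p \<in> ?rhs" unfolding projectivization_def by blast
  qed
  show "?rhs \<subseteq> ?lhs"
  proof
    fix p assume "p \<in> ?rhs"
    then obtain u where u: "u \<in> vec_space.row_space (n choose d) (hyperplane_minors d n W)"
      "u \<noteq> 0\<^sub>v (n choose d)" "p = span_of (n choose d) {u}"
      unfolding projectivization_def by blast
    then obtain v where v: "v \<in> carrier_vec (d + 1)" "u = (hyperplane_minors d n W)\<^sup>T *\<^sub>v v"
      using mem_row_space_iff[OF V] by blast
    have v0: "v \<noteq> 0\<^sub>v (d + 1)" using u(2) v V by auto
    obtain B where B: "B \<in> carrier_mat d (d + 1)" "independent_rows B" "B *\<^sub>v v = 0\<^sub>v d"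
      using ex_matrix_with_kernel_vector[OF v(1) v0] by blast
    have BW: "B * W \<in> carrier_mat d n" using B W by simp
    have "independent_rows (B * W)" using independent_rows_mult_iff[OF B(1) W indW] B(2) by simp
    hence "vec_space.row_space n (B * W) \<in> grassmannian d n"
      using subspace_dim_row_space_iff[OF BW] subspace_of_row_space[OF BW]
      unfolding grassmannian_def by simp
    moreover have "vec_space.row_space n (B * W) \<subseteq> vec_space.row_space n W"
      using row_space_subset_iff_factor[OF BW W] B(1) by blast
    ultimately have "vec_space.row_space n (B * W) \<in> L d n (vec_space.row_space n W)"
      by (simp add: mem_L_iff)
    moreover have "p = plucker_embedding n d (vec_space.row_space n (B * W))"
      using plucker_embedding_hyperplane[OF B(1,2) v(1) v0 B(3) W indW] u(3) v(2) by simp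
    ultimately show "p \<in> ?lhs" by blast
  qed
qed

section \<open>Projection along coordinates and the space \<open>X\<^sup>S\<close>\<close>

text \<open>The normalized matrix is \<open>(A\<^sup>C)\<^sup>-\<^sup>1 A\<close>. It is unique because two matrices with the same row space
  differ by a left factor, and comparing the columns \<open>C\<close> shows that this factor is the identity.\<close>
lemma normalized_matrix_properties:
  fixes A :: "'a::field mat"
  assumes A: "A \<in> carrier_mat (card C) n" and C: "C \<subseteq> {0..<n}"
    and det: "det (columns A C) \<noteq> 0" and X: "vec_space.row_space n A = X"
  shows "normalized_matrix n C X \<in> carrier_mat (card C) n"
    and "vec_space.row_space n (normalized_matrix n C X) = X"
    and "columns (normalized_matrix n C X) C = 1\<^sub>m (card C)"
proof -
  let ?m = "card C"
  let ?P = "\<lambda>W. W \<in> carrier_mat ?m n \<and> vec_space.row_space n W = X \<and> columns W C = 1\<^sub>m ?m"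
  have AC: "columns A C \<in> carrier_mat ?m ?m" by (rule columns_carrier[OF A C])
  obtain G where G: "G \<in> carrier_mat ?m ?m" "G * columns A C = 1\<^sub>m ?m" "columns A C * G = 1\<^sub>m ?m"
    using det_non_zero_imp_unit[OF AC det, of undefined] unfolding Units_def
    by (auto simp: ring_mat_simps)
  have GA: "G * A \<in> carrier_mat ?m n" using G A by simp
  have "A = columns A C * (G * A)"
    using assoc_mult_mat[OF AC G(1) A] G(3) A by simp
  hence "vec_space.row_space n (G * A) = X"
    using row_space_subset_iff_factor[OF GA A] row_space_subset_iff_factor[OF A GA] G(1) AC X
    by (metis subset_antisym)
  hence ex: "?P (G * A)" using GA columns_mult[OF G(1) A C] G(2) by simp
  have uniq: "W = G * A" if W: "?P W" for W
  proof -
    obtain B where B: "B \<in> carrier_mat ?m ?m" "W = B * (G * A)"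
      using row_space_subset_iff_factor[of W ?m n "G * A" ?m] W ex by auto
    have "B = 1\<^sub>m ?m" using columns_mult[OF B(1) GA C] B ex W by simp
    thus ?thesis using B(2) left_mult_one_mat[OF GA] by simp
  qed
  have "?P (normalized_matrix n C X)"
    unfolding normalized_matrix_def using ex uniq by (rule theI)
  thus "normalized_matrix n C X \<in> carrier_mat (card C) n"
    "vec_space.row_space n (normalized_matrix n C X) = X"
    "columns (normalized_matrix n C X) C = 1\<^sub>m (card C)" by auto
qed

lemma W_S_carrier: "W_S n S C X \<in> carrier_mat (card C) n"
  unfolding W_S_def by (intro carrier_matI) simp_all

lemma W_S_index:
  assumes "normalized_matrix n C X \<in> carrier_mat (card C) n" and "k < card C" and "j < n"
  shows "W_S n S C X $$ (k, j)
    = (if pick C k \<in> S then (if j = pick C k then 1 else 0) else normalized_matrix n C X $$ (k, j))"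
  using assms unfolding W_S_def by (auto simp: mat_of_rows_index unit_vec_def)

lemma columns_W_S:
  fixes X :: "'a::field vec set"
  assumes W: "normalized_matrix n C X \<in> carrier_mat (card C) n" and C: "C \<subseteq> {0..<n}"
    and WC: "columns (normalized_matrix n C X) C = 1\<^sub>m (card C)"
  shows "columns (W_S n S C X) C = 1\<^sub>m (card C)"
proof (rule eq_matI)
  fix k j assume "k < dim_row (1\<^sub>m (card C) :: 'a mat)" "j < dim_col (1\<^sub>m (card C) :: 'a mat)"
  hence kj: "k < card C" "j < card C" by auto
  have "columns (W_S n S C X) C $$ (k, j) = W_S n S C X $$ (k, pick C j)"
    by (rule columns_index[OF W_S_carrier C kj])
  also have "\<dots> = (if pick C k \<in> S then (if pick C j = pick C k then 1 else 0)
      else columns (normalized_matrix n C X) C $$ (k, j))"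
    unfolding W_S_index[OF W kj(1) pick_less[OF C kj(2)]] columns_index[OF W C kj] by (rule refl)
  also have "\<dots> = (1\<^sub>m (card C) :: 'a mat) $$ (k, j)"
    unfolding WC pick_eq_iff[OF kj(2,1)] using kj by simp
  finally show "columns (W_S n S C X) C $$ (k, j) = (1\<^sub>m (card C) :: 'a mat) $$ (k, j)" .
qed (use columns_carrier[OF W_S_carrier[of n S C X] C] in auto)

text \<open>The projection removes exactly the contribution of the rows labelled by \<open>S\<close>. The rows of the
  normalized matrix that survive have zeros in the columns \<open>S\<close> already, as \<open>S \<subseteq> C\<close>.\<close>
lemma pr_W_S_combination:
  fixes X :: "'a::field vec set"
  assumes W: "normalized_matrix n C X \<in> carrier_mat (card C) n" and C: "C \<subseteq> {0..<n}"
    and WC: "columns (normalized_matrix n C X) C = 1\<^sub>m (card C)"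
    and S: "S \<subseteq> C" and b: "b \<in> carrier_vec (card C)"
  shows "pr n S ((W_S n S C X)\<^sup>T *\<^sub>v b)
    = (normalized_matrix n C X)\<^sup>T *\<^sub>v vec (card C) (\<lambda>k. if pick C k \<in> S then 0 else b $ k)"
    (is "_ = ?W\<^sup>T *\<^sub>v ?b0")
proof (rule eq_vecI)
  fix j assume "j < dim_vec (?W\<^sup>T *\<^sub>v ?b0)"
  hence j: "j < n" using W by simp
  show "pr n S ((W_S n S C X)\<^sup>T *\<^sub>v b) $ j = (?W\<^sup>T *\<^sub>v ?b0) $ j"
  proof (cases "j \<in> S")
    case True
    then obtain l where l: "l < card C" "pick C l = j"
      using ex_pick[of C j] S C finite_subset by blast
    have "(?W\<^sup>T *\<^sub>v ?b0) $ j = ?b0 $ l"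
      using pivot_coordinates[OF W C refl WC _ l(1), of ?b0] l(2) by simp
    thus ?thesis using True l j by (simp add: pr_def)
  next
    case False
    have "(\<Sum>k = 0..<card C. W_S n S C X $$ (k, j) * b $ k)
        = (\<Sum>k = 0..<card C. ?W $$ (k, j) * (if pick C k \<in> S then 0 else b $ k))"
      using W_S_index[OF W _ j] False by (intro sum.cong) auto
    thus ?thesis using False j W b W_S_carrier[of n S C X]
      by (simp add: pr_def scalar_prod_def)
  qed
qed (use W in \<open>simp add: pr_def\<close>)

text \<open>In the forward direction the only possible coefficients of \<open>y\<close> are its own coordinates in \<open>C\<close>.
  The combination with these coefficients agrees with \<open>y\<close> outside \<open>S\<close> because the two have the same
  projection, and inside \<open>S\<close> because \<open>S \<subseteq> C\<close> consists of pivot columns.\<close>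
lemma pr_mem_iff_mem_X_S:
  fixes X :: "'a::field vec set"
  assumes W: "normalized_matrix n C X \<in> carrier_mat (card C) n" and C: "C \<subseteq> {0..<n}"
    and WX: "vec_space.row_space n (normalized_matrix n C X) = X"
    and WC: "columns (normalized_matrix n C X) C = 1\<^sub>m (card C)"
    and S: "S \<subseteq> C" and y: "y \<in> carrier_vec n"
  shows "pr n S y \<in> X \<longleftrightarrow> y \<in> X_S n S C X"
proof
  let ?W = "normalized_matrix n C X"
  note mem_X = mem_row_space_iff[OF W, unfolded WX]
  note mem_X_S = mem_row_space_iff[OF W_S_carrier[of n S C X], folded X_S_def]
  note combination = pr_W_S_combination[OF W C WC S]
  show "pr n S y \<in> X" if "y \<in> X_S n S C X"
    using that combination unfolding mem_X mem_X_S by (metis vec_carrier)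
  assume "pr n S y \<in> X"
  then obtain b where b: "b \<in> carrier_vec (card C)" "pr n S y = ?W\<^sup>T *\<^sub>v b"
    unfolding mem_X by blast
  define b' where "b' = vec (card C) (\<lambda>k. y $ pick C k)"
  have b': "b' \<in> carrier_vec (card C)" unfolding b'_def by simp
  have "vec (card C) (\<lambda>k. if pick C k \<in> S then 0 else b' $ k) = b"
  proof (rule eq_vecI)
    fix k assume "k < dim_vec b"
    hence k: "k < card C" using b(1) by simp
    have "b $ k = pr n S y $ pick C k"
      using pivot_coordinates[OF W C refl WC b(1) k] b(2) by simp
    thus "vec (card C) (\<lambda>k. if pick C k \<in> S then 0 else b' $ k) $ k = b $ k"
      using k pick_less[OF C k] by (simp add: pr_def b'_def)
  qed (use b in simp)
  hence pr_eq: "pr n S ((W_S n S C X)\<^sup>T *\<^sub>v b') = pr n S y" using combination[OF b'] b(2) by simp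
  have "y = (W_S n S C X)\<^sup>T *\<^sub>v b'"
  proof (rule eq_vecI)
    fix j assume "j < dim_vec ((W_S n S C X)\<^sup>T *\<^sub>v b')"
    hence j: "j < n" using W_S_carrier[of n S C X] by simp
    show "y $ j = ((W_S n S C X)\<^sup>T *\<^sub>v b') $ j"
    proof (cases "j \<in> S")
      case True
      then obtain l where l: "l < card C" "pick C l = j"
        using ex_pick[of C j] S C finite_subset by blast
      have "((W_S n S C X)\<^sup>T *\<^sub>v b') $ j = b' $ l"
        using pivot_coordinates[OF W_S_carrier C refl columns_W_S[OF W C WC] b' l(1)] l(2) by simp
      thus ?thesis using l by (simp add: b'_def)
    next
      case False
      thus ?thesis using arg_cong[OF pr_eq, of "\<lambda>u. u $ j"] j by (simp add: pr_def)
    qed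
  qed (use y W_S_carrier[of n S C X] in auto)
  thus "y \<in> X_S n S C X" unfolding mem_X_S using b' by blast
qed

theorem theorem17:
  fixes X :: "'a::alg_closed_field vec set"
    and q :: "nat set \<Rightarrow> 'a"
    and S C :: "nat set"
    and d n :: nat
  assumes "1 \<le> d" and "d \<le> n - 1"
    and "subspace_of n X" and "subspace_dim n X = d + 1"
    and "plucker_coords n (d + 1) X q"
    and "S \<subseteq> {0..<n}"
    and "C \<subseteq> {0..<n}" and "card C = d + 1" and "S \<subseteq> C" and "q C \<noteq> 0"
  shows "LS d n S X = L d n (X_S n S C X) \<and>
         linear_of_proj_dim (n choose d) (plucker_embedding n d ` LS d n S X) d \<and>
         plucker_embedding n d ` LS d n S X
           = projectivization (n choose d) (vec_space.row_space (n choose d) (V_S d n S C X))"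
proof -
  note C = \<open>C \<subseteq> {0..<n}\<close> and cardC = \<open>card C = d + 1\<close>
  obtain A c where A: "A \<in> carrier_mat (d + 1) n" "vec_space.row_space n A = X"
    and qA: "\<forall>I \<subseteq> {0..<n}. card I = d + 1 \<longrightarrow> q I = c * det (columns A I)"
    using \<open>plucker_coords n (d + 1) X q\<close> unfolding plucker_coords_def by blast
  have "det (columns A C) \<noteq> 0" using qA C cardC \<open>q C \<noteq> 0\<close> by auto
  note N = normalized_matrix_properties[OF A(1)[folded cardC] C this A(2)]
  have WS: "W_S n S C X \<in> carrier_mat (d + 1) n" using W_S_carrier[of n S C X] cardC by simp
  have WSC: "columns (W_S n S C X) C = 1\<^sub>m (d + 1)" using columns_W_S[OF N(1) C N(3)] cardC by simp
  have VS: "V_S d n S C X = hyperplane_minors d n (W_S n S C X)"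
    unfolding V_S_def hyperplane_minors_def ..
  have indV: "independent_rows (V_S d n S C X)"
    unfolding VS by (rule independent_rows_hyperplane_minors[OF WS C cardC WSC])
  have "pr n S ` Y \<subseteq> X \<longleftrightarrow> Y \<subseteq> X_S n S C X" if "Y \<in> grassmannian d n" for Y
    using pr_mem_iff_mem_X_S[OF N(1) C N(2,3) \<open>S \<subseteq> C\<close>] grassmannian_carrier[OF that] by blast
  hence LS: "LS d n S X = L d n (X_S n S C X)" unfolding LS_def[of d n S] mem_L_iff set_eq_iff by auto
  have image: "plucker_embedding n d ` LS d n S X
      = projectivization (n choose d) (vec_space.row_space (n choose d) (V_S d n S C X))"
    unfolding LS X_S_def VS
    using plucker_image_L[OF WS independent_rows_pivots[OF WS C cardC WSC]] indV VS by simp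
  have V: "V_S d n S C X \<in> carrier_mat (d + 1) (n choose d)"
    unfolding VS by (rule hyperplane_minors_carrier)
  have "linear_of_proj_dim (n choose d) (plucker_embedding n d ` LS d n S X) d"
    unfolding linear_of_proj_dim_def image
    using subspace_of_row_space[OF V] subspace_dim_row_space_iff[OF V] indV by blast
  thus ?thesis using LS image by blast
qed

end
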